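(* Let $d_1,d_2,d_3,\dots$ be independent random variables with $d_1$ uniform on $\{1,2,\dots,9\}$ and $d_j$ uniform on $\{0,1,\dots,9\}$ for all $j\ge 2$ (the digits of a random real number in base $10$). The probability that there is a $k\ge 1$ with $d_1+d_2+\dots+d_k=666$ is the number whose decimal expansion begins $$0.1\underbrace{99\cdots 9}_{62\text{ nines}}78337773162864760552794625\dots$$
   Context: A real number is called $n$-evil to base $b$ if, after removing the base-$b$ point, one of the partial sums of its sequence of base-$b$ digits equals $n$. A random real number in base $b$ is modelled by a uniformly random infinite string of digits from $\{0,1,\dots,b-1\}$ whose first digit is conditioned to be nonzero. Here $b=10$ and $n=666$. *)

theory Defs
  imports "HOL-Probability.Probability"
begin

text \<open>
  The \<open>j\<close>-th decimal digit after the point of a nonnegative real, \<open>j \<ge> 1\<close>. Taking the floor selects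
  the expansion that does not end in an infinite run of nines.
\<close>

definition decimal_digit :: "real \<Rightarrow> nat \<Rightarrow> int" where
  "decimal_digit x j = \<lfloor>x * 10 ^ j\<rfloor> mod 10"

definition decimal_expansion_begins :: "real \<Rightarrow> nat \<Rightarrow> int list \<Rightarrow> bool" where
  "decimal_expansion_begins x m ds \<longleftrightarrow>
     \<lfloor>x\<rfloor> = int m \<and> (\<forall>j<length ds. decimal_digit x (Suc j) = ds ! j)"

end

theory Submission
  imports Defs
begin

text \<open>
  Let \<open>q n\<close> be the probability that some digit sum equals \<open>n\<close>. Zero digits do not change the sum, so
  the sequence of distinct sums is a renewal process whose steps, the first one included, are
  uniform on \<open>{1..9}\<close>. Hence \<open>q n\<close> is the mean of the nine preceding values, where the value at \<open>0\<close>
  is taken to be \<open>1\<close> and the values at negative arguments are \<open>0\<close>. In the proof the zeros are not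
  removed from the sequence. Instead, \<open>q n\<close> is computed as a sum over the times at which a nonzero
  digit brings the sum to \<open>n\<close> (\<open>arrive_sums\<close>), and the expected number of times that the sum
  equals \<open>n\<close> is \<open>10/9\<close> of it, since a sum is kept for another step with probability \<open>1/10\<close>
  (\<open>visit_sums\<close>). Together with independence this gives \<open>hit_renewal\<close>.

  The value \<open>q 666\<close> is within about \<open>10 powr (-64)\<close> of the limit \<open>1/5\<close>, which is the cause of the run
  of nines. To get the digits after that run, the recurrence is carried out in integer
  arithmetic on the scale \<open>10 ^ 94\<close>, with every mean rounded down. Averaging does not enlarge an error
  bound that the nine values share, and each rounding adds less than one unit, so that after 666
  steps the result is too small by at most 666 units (\<open>avg_run_error\<close>). The five guard digits beyond
  the 89 required ones absorb this. The computation itself is \<open>avg_run_666\<close>.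
\<close>

section \<open>The renewal recurrence for the hitting probabilities\<close>

locale random_digits = prob_space M for M :: "'a measure" +
  fixes d :: "nat \<Rightarrow> 'a \<Rightarrow> nat"
  assumes indep: "indep_vars (\<lambda>_. count_space UNIV) d {1..}"
    and first_digit: "distr M (count_space UNIV) (d 1) = measure_pmf (pmf_of_set {1..9})"
    and later_digit:
      "\<And>j. j \<ge> 2 \<Longrightarrow> distr M (count_space UNIV) (d j) = measure_pmf (pmf_of_set {0..9})"
begin

definition digit_sum :: "nat \<Rightarrow> 'a \<Rightarrow> nat" where
  "digit_sum k \<omega> = (\<Sum>j=1..k. d j \<omega>)"

definition hit :: "nat \<Rightarrow> real" where
  "hit n = prob {\<omega> \<in> space M. \<exists>k\<ge>1. digit_sum k \<omega> = n}"

text \<open>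
  The first digit has its own distribution, so that the recursions in \<open>k\<close> start with a sum of one
  digit. The indices are shifted to make the series range over all of \<open>nat\<close>.
\<close>

definition visit :: "nat \<Rightarrow> nat \<Rightarrow> real" where
  "visit k n = prob {\<omega> \<in> space M. digit_sum (Suc k) \<omega> = n}"

definition arrive :: "nat \<Rightarrow> nat \<Rightarrow> real" where
  "arrive k n = prob {\<omega> \<in> space M. digit_sum (Suc (Suc k)) \<omega> = n \<and> d (Suc (Suc k)) \<omega> \<noteq> 0}"

lemma measurable_digit [measurable]:
  "j \<ge> 1 \<Longrightarrow> d j \<in> measurable M (count_space UNIV)"
  using indep unfolding indep_vars_def by simp

lemma digit_sum_Suc: "digit_sum (Suc k) \<omega> = digit_sum k \<omega> + d (Suc k) \<omega>"
  by (simp add: digit_sum_def)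

lemma measurable_digit_sum [measurable]:
  "digit_sum k \<in> measurable M (count_space UNIV)"
proof (induction k)
  case 0
  then show ?case by (simp add: digit_sum_def)
next
  case (Suc k)
  note [measurable] = Suc
  have [measurable]: "d (Suc k) \<in> measurable M (count_space UNIV)"
    by (rule measurable_digit) simp
  have "(\<lambda>\<omega>. digit_sum k \<omega> + d (Suc k) \<omega>) \<in> measurable M (count_space UNIV)"
    by measurable
  then show ?case
    by (simp add: digit_sum_Suc[abs_def])
qed

lemma prob_digit:
  assumes "j \<ge> 1" and "distr M (count_space UNIV) (d j) = measure_pmf p"
  shows "prob {\<omega> \<in> space M. d j \<omega> = i} = pmf p i"
proof -
  have "prob (d j -` {i} \<inter> space M) = measure (distr M (count_space UNIV) (d j)) {i}"
    using assms(1) by (intro measure_distr[symmetric]) auto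
  also have "d j -` {i} \<inter> space M = {\<omega> \<in> space M. d j \<omega> = i}"
    by auto
  finally show ?thesis
    using assms(2) by (simp add: measure_pmf_single)
qed

lemma prob_first_digit:
  "prob {\<omega> \<in> space M. d 1 \<omega> = i} = (if i \<in> {1..9} then 1 / 9 else 0)"
  using prob_digit[OF _ first_digit, of i] by (auto simp: indicator_def)

lemma prob_later_digit:
  "prob {\<omega> \<in> space M. d (Suc (Suc k)) \<omega> = i} = (if i \<le> 9 then 1 / 10 else 0)"
  using prob_digit[OF _ later_digit, of "Suc (Suc k)" i] by (auto simp: indicator_def)

text \<open>
  The passage to \<open>real\<close> makes \<open>indep_vars_sum\<close> applicable, by which the new digit is independent of
  the sum of the earlier ones.
\<close>

lemma prob_sum_next_digit:
  "prob {\<omega> \<in> space M. digit_sum k \<omega> = m \<and> d (Suc k) \<omega> = i}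
    = prob {\<omega> \<in> space M. digit_sum k \<omega> = m} * prob {\<omega> \<in> space M. d (Suc k) \<omega> = i}"
proof -
  have "indep_vars (\<lambda>_. borel) (\<lambda>j \<omega>. real (d j \<omega>)) {1..}"
    by (rule indep_vars_compose2[OF indep]) simp
  then have "indep_vars (\<lambda>_. borel) (\<lambda>j \<omega>. real (d j \<omega>)) (insert (Suc k) {1..k})"
    by (rule indep_vars_subset) auto
  then have "indep_var borel (\<lambda>\<omega>. real (d (Suc k) \<omega>)) borel (\<lambda>\<omega>. \<Sum>j\<in>{1..k}. real (d j \<omega>))"
    by (intro indep_vars_sum) auto
  from indep_varD[OF this, of "{real i}" "{real m}"] show ?thesis
    unfolding of_nat_sum[symmetric] digit_sum_def[symmetric]
    by (simp add: vimage_def Int_def conj_commute mult.commute)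
qed

lemma arrive_eq: "arrive k n = (\<Sum>i\<in>{1..n} \<inter> {..9}. visit k (n - i)) / 10"
proof -
  let ?A = "\<lambda>i. {\<omega> \<in> space M. digit_sum (Suc k) \<omega> = n - i \<and> d (Suc (Suc k)) \<omega> = i}"
  have [measurable]: "d (Suc (Suc k)) \<in> measurable M (count_space UNIV)"
    by (rule measurable_digit) simp
  have "{\<omega> \<in> space M. digit_sum (Suc (Suc k)) \<omega> = n \<and> d (Suc (Suc k)) \<omega> \<noteq> 0} = (\<Union>i\<in>{1..n}. ?A i)"
    by (auto simp: digit_sum_Suc[of "Suc k"])
  then have "arrive k n = (\<Sum>i=1..n. prob (?A i))"
    unfolding arrive_def
    by (simp only:) (intro finite_measure_finite_Union, auto simp: disjoint_family_on_def)
  also have "\<dots> = (\<Sum>i=1..n. if i \<in> {..9} then visit k (n - i) / 10 else 0)"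
    by (intro sum.cong) (simp_all add: prob_sum_next_digit prob_later_digit visit_def)
  also have "\<dots> = (\<Sum>i\<in>{1..n} \<inter> {..9}. visit k (n - i) / 10)"
    by (rule sum.inter_restrict[symmetric]) simp
  finally show ?thesis
    by (simp only: sum_divide_distrib)
qed

lemma visit_Suc: "visit (Suc k) n = arrive k n + visit k n / 10"
proof -
  let ?Z = "{\<omega> \<in> space M. digit_sum (Suc k) \<omega> = n \<and> d (Suc (Suc k)) \<omega> = 0}"
  let ?N = "{\<omega> \<in> space M. digit_sum (Suc (Suc k)) \<omega> = n \<and> d (Suc (Suc k)) \<omega> \<noteq> 0}"
  have [measurable]: "d (Suc (Suc k)) \<in> measurable M (count_space UNIV)"
    by (rule measurable_digit) simp
  have "{\<omega> \<in> space M. digit_sum (Suc (Suc k)) \<omega> = n} = ?N \<union> ?Z"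
    by (auto simp: digit_sum_Suc[of "Suc k"])
  then have "visit (Suc k) n = prob ?N + prob ?Z"
    unfolding visit_def by (simp only:) (intro finite_measure_Union, auto)
  then show ?thesis
    by (simp add: prob_sum_next_digit prob_later_digit arrive_def visit_def)
qed

text \<open>
  At the earliest time at which the sum is \<open>n\<close>, either only one digit has been read or the last digit
  was nonzero. No later time has this property, because the sums never decrease. So the event of
  hitting \<open>n\<close> is a disjoint union over the time of arrival.
\<close>

lemma arrive_sums: "(\<lambda>k. arrive k n) sums (hit n - visit 0 n)"
proof -
  define A where "A k = (case k of
      0 \<Rightarrow> {\<omega> \<in> space M. digit_sum 1 \<omega> = n}
    | Suc k \<Rightarrow> {\<omega> \<in> space M. digit_sum (Suc (Suc k)) \<omega> = n \<and> d (Suc (Suc k)) \<omega> \<noteq> 0})" for k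
  have A_Suc: "A (Suc k) =
    {\<omega> \<in> space M. digit_sum (Suc (Suc k)) \<omega> = n \<and> d (Suc (Suc k)) \<omega> \<noteq> 0}" for k
    by (simp add: A_def)
  have A_sub: "A k \<subseteq> {\<omega> \<in> space M. digit_sum (Suc k) \<omega> = n}" for k
    by (cases k) (auto simp: A_def)
  have "A k \<in> events" for k
  proof (cases k)
    case (Suc l)
    have [measurable]: "d (Suc (Suc l)) \<in> measurable M (count_space UNIV)"
      by (rule measurable_digit) simp
    show ?thesis unfolding Suc A_Suc by measurable
  qed (simp add: A_def)
  moreover have "A k \<inter> A l = {}" if "k < l" for k l
  proof -
    from that obtain l' where l: "l = Suc l'" "k \<le> l'"
      by (cases l) auto
    have "digit_sum (Suc k) \<omega> \<le> digit_sum (Suc l') \<omega>" for \<omega>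
      unfolding digit_sum_def using l(2) by (intro sum_mono2) auto
    then have "digit_sum (Suc k) \<omega> < digit_sum (Suc (Suc l')) \<omega>" if "d (Suc (Suc l')) \<omega> \<noteq> 0" for \<omega>
      using that digit_sum_Suc[of "Suc l'" \<omega>] by (metis add_gr_0 le_less_trans less_add_same_cancel1 gr0I)
    then show ?thesis
      using A_sub[of k] unfolding l(1) A_Suc by fastforce
  qed
  then have "disjoint_family A"
    unfolding disjoint_family_on_def by (metis Int_commute linorder_neqE_nat)
  ultimately have "(\<lambda>k. prob (A k)) sums prob (\<Union>k. A k)"
    by (intro finite_measure_UNION) auto
  also have "(\<Union>k. A k) = {\<omega> \<in> space M. \<exists>k\<ge>1. digit_sum k \<omega> = n}" (is "_ = ?H")
  proof (intro equalityI subsetI)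
    fix \<omega> assume "\<omega> \<in> (\<Union>k. A k)"
    then show "\<omega> \<in> ?H" using A_sub by fastforce
  next
    fix \<omega> assume "\<omega> \<in> ?H"
    then have "\<omega> \<in> space M" and ex: "\<exists>k. digit_sum (Suc k) \<omega> = n"
      by (auto simp: Suc_le_eq gr0_conv_Suc)
    define k where "k = (LEAST k. digit_sum (Suc k) \<omega> = n)"
    have k: "digit_sum (Suc k) \<omega> = n"
      unfolding k_def using ex by (rule LeastI_ex)
    have least: "digit_sum (Suc l) \<omega> \<noteq> n" if "l < k" for l
      using not_less_Least[of l] that unfolding k_def by blast
    have "\<omega> \<in> A k"
    proof (cases k)
      case 0
      then show ?thesis using k \<open>\<omega> \<in> space M\<close> by (simp add: A_def)
    next
      case (Suc l)
      then show ?thesis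
        using k least[of l] \<open>\<omega> \<in> space M\<close> by (auto simp: A_Suc digit_sum_Suc[of "Suc l"])
    qed
    then show "\<omega> \<in> (\<Union>k. A k)" by blast
  qed
  finally have "(\<lambda>k. prob (A k)) sums hit n"
    unfolding hit_def .
  then have "(\<lambda>k. prob (A (Suc k))) sums (hit n - prob (A 0))"
    by (subst sums_Suc_iff[of "\<lambda>k. prob (A k)"]) simp
  then show ?thesis
    by (simp add: A_def arrive_def visit_def)
qed

text \<open>
  Summing \<open>visit_Suc\<close> over \<open>k < m\<close> expresses the partial sums of the visits by those of the arrivals
  and the single term \<open>visit m n\<close>. The arrivals bound the partial sums, so the visits are summable;
  then this last term vanishes in the limit.
\<close>

lemma visit_sums: "(\<lambda>k. visit k n) sums (10 / 9 * hit n)"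
proof -
  have partial: "(\<Sum>k<m. visit k n)
      = 10 / 9 * (visit 0 n + (\<Sum>k<m. arrive k n) - visit m n)" for m
    by (induction m) (simp_all add: visit_Suc field_simps)
  have "(\<Sum>k<m. arrive k n) \<le> hit n - visit 0 n" for m
    using sum_le_suminf[OF sums_summable[OF arrive_sums], of "{..<m}" n]
    unfolding sums_unique[OF arrive_sums, symmetric] by (simp add: arrive_def)
  moreover have "0 \<le> visit m n" for m
    by (simp add: visit_def)
  ultimately have "visit 0 n + (\<Sum>k<m. arrive k n) - visit m n \<le> hit n" for m
    by (smt (verit))
  then have "(\<Sum>k<m. visit k n) \<le> 10 / 9 * hit n" for m
    unfolding partial by (intro mult_left_mono) auto
  then have "summable (\<lambda>k. visit k n)"
    by (intro summableI_nonneg_bounded[where x = "10 / 9 * hit n"]) (auto simp: visit_def)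
  then have "(\<lambda>m. visit m n) \<longlonglongrightarrow> 0"
    by (rule summable_LIMSEQ_zero)
  then have "(\<lambda>m. 10 / 9 * (visit 0 n + (\<Sum>k<m. arrive k n) - visit m n))
      \<longlonglongrightarrow> 10 / 9 * (visit 0 n + (hit n - visit 0 n) - 0)"
    using arrive_sums[unfolded sums_def] by (intro tendsto_intros)
  then show ?thesis
    by (simp add: sums_def partial)
qed

lemma hit_renewal:
  "hit n = ((if n \<in> {1..9} then 1 else 0) + (\<Sum>i\<in>{1..n} \<inter> {..9}. hit (n - i))) / 9"
proof -
  have "(\<lambda>k. arrive k n) sums ((\<Sum>i\<in>{1..n} \<inter> {..9}. 10 / 9 * hit (n - i)) / 10)"
    unfolding arrive_eq by (intro sums_divide sums_sum visit_sums)
  then have "hit n - visit 0 n = (\<Sum>i\<in>{1..n} \<inter> {..9}. 10 / 9 * hit (n - i)) / 10"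
    using arrive_sums sums_unique2 by blast
  moreover have "visit 0 n = (if n \<in> {1..9} then 1 / 9 else 0)"
    unfolding visit_def using prob_first_digit by (simp add: digit_sum_def)
  ultimately have "hit n - (if n \<in> {1..9} then 1 / 9 else 0)
      = 10 / 9 * (\<Sum>i\<in>{1..n} \<inter> {..9}. hit (n - i)) / 10"
    by (simp only: sum_distrib_left)
  then show ?thesis
    by (simp add: field_simps split: if_splits)
qed

text \<open>
  The sequence \<open>q\<close> with the value \<open>1\<close> at \<open>0\<close> and eight zeros in front of it, moved to start at index
  \<open>0\<close>. For it the recurrence has no boundary terms. The \<open>1\<close> stands for the empty sum, whereas
  \<open>hit 0\<close> is \<open>0\<close> because the first digit is not zero.
\<close>

definition padded_hit :: "nat \<Rightarrow> real" where
  "padded_hit j = (if j < 8 then 0 else if j = 8 then 1 else hit (j - 8))"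

lemma padded_hit_average: "padded_hit (m + 9) = (\<Sum>i<9. padded_hit (m + i)) / 9"
proof -
  have hit_0: "hit 0 = 0"
    by (subst hit_renewal) simp
  have "(\<Sum>i<9. padded_hit (m + i)) = (\<Sum>i\<in>{1..9}. padded_hit (m + 9 - i))"
    by (rule sum.reindex_bij_witness[where i = "\<lambda>i. 9 - i" and j = "\<lambda>i. 9 - i"]) auto
  also have "\<dots> = (\<Sum>i\<in>{1..9}. (if i = m + 1 then 1 else 0)
      + (if i \<in> {1..m + 1} then hit (m + 1 - i) else 0))"
    by (intro sum.cong refl) (auto simp: padded_hit_def hit_0)
  also have "\<dots> = (if m + 1 \<in> {1..9} then 1 else 0)
      + (\<Sum>i\<in>{1..9} \<inter> {1..m + 1}. hit (m + 1 - i))"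
    by (simp only: sum.distrib sum.inter_restrict[OF finite_atLeastAtMost]) simp
  also have "{1..9} \<inter> {1..m + 1} = {1..m + 1} \<inter> {..9}"
    by auto
  finally show ?thesis
    using hit_renewal[of "m + 1"] by (simp add: padded_hit_def)
qed

end

section \<open>Floored moving averages\<close>

text \<open>
  The 666 divisions by nine of numbers with more than 300 binary digits have to be done by
  rewriting. The general division algorithm compares and subtracts long numbers at every bit.
  Schoolbook long division from the most significant bit needs only the remainder so far. With the
  nine remainders as constructors, each bit costs one table lookup, namely one equation of
  \<open>push_bit\<close>: if \<open>2 r + b = 9 c + r'\<close> for a bit \<open>b\<close>, then \<open>(q, r)\<close> becomes \<open>(2 q + c, r')\<close>.
\<close>

datatype residue = R0 | R1 | R2 | R3 | R4 | R5 | R6 | R7 | R8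

fun residue_val :: "residue \<Rightarrow> int" where
  "residue_val R0 = 0"
| "residue_val R1 = 1"
| "residue_val R2 = 2"
| "residue_val R3 = 3"
| "residue_val R4 = 4"
| "residue_val R5 = 5"
| "residue_val R6 = 6"
| "residue_val R7 = 7"
| "residue_val R8 = 8"

fun push_bit :: "bool \<Rightarrow> int \<times> residue \<Rightarrow> int \<times> residue" where
  "push_bit False (q, R0) = (Int.dup q, R0)"
| "push_bit False (q, R1) = (Int.dup q, R2)"
| "push_bit False (q, R2) = (Int.dup q, R4)"
| "push_bit False (q, R3) = (Int.dup q, R6)"
| "push_bit False (q, R4) = (Int.dup q, R8)"
| "push_bit False (q, R5) = (Int.dup q + 1, R1)"
| "push_bit False (q, R6) = (Int.dup q + 1, R3)"
| "push_bit False (q, R7) = (Int.dup q + 1, R5)"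
| "push_bit False (q, R8) = (Int.dup q + 1, R7)"
| "push_bit True (q, R0) = (Int.dup q, R1)"
| "push_bit True (q, R1) = (Int.dup q, R3)"
| "push_bit True (q, R2) = (Int.dup q, R5)"
| "push_bit True (q, R3) = (Int.dup q, R7)"
| "push_bit True (q, R4) = (Int.dup q + 1, R0)"
| "push_bit True (q, R5) = (Int.dup q + 1, R2)"
| "push_bit True (q, R6) = (Int.dup q + 1, R4)"
| "push_bit True (q, R7) = (Int.dup q + 1, R6)"
| "push_bit True (q, R8) = (Int.dup q + 1, R8)"

fun div_rem_nine :: "num \<Rightarrow> int \<times> residue" where
  "div_rem_nine num.One = (0, R1)"
| "div_rem_nine (num.Bit0 n) = push_bit False (div_rem_nine n)"
| "div_rem_nine (num.Bit1 n) = push_bit True (div_rem_nine n)"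

lemma push_bit_correct:
  "9 * fst (push_bit b p) + residue_val (snd (push_bit b p))
     = 2 * (9 * fst p + residue_val (snd p)) + of_bool b"
  by (cases "(b, p)" rule: push_bit.cases) (simp_all add: Int.dup_def)

lemma div_rem_nine_correct:
  "numeral n = 9 * fst (div_rem_nine n) + residue_val (snd (div_rem_nine n))"
proof (induction n)
  case (Bit0 n)
  then show ?case by (simp add: push_bit_correct)
next
  case (Bit1 n)
  then show ?case by (simp add: push_bit_correct)
qed simp

text \<open>
  A separate constant for \<open>x div 9\<close>, so that the fast algorithm can be its code equation.
\<close>

definition ninth :: "int \<Rightarrow> int" where
  "ninth x = x div 9"

lemma ninth_code [code]:
  "ninth 0 = 0"
  "ninth (Int.Pos n) = fst (div_rem_nine n)"
  "ninth (Int.Neg n) = Int.Neg n div 9"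
proof -
  have "0 \<le> residue_val r \<and> residue_val r < 9" for r
    by (cases r) simp_all
  then have "0 \<le> residue_val (snd (div_rem_nine n))" "residue_val (snd (div_rem_nine n)) < 9"
    by blast+
  then show "ninth (Int.Pos n) = fst (div_rem_nine n)"
    unfolding ninth_def Int.Pos_def using div_rem_nine_correct[of n] by linarith
qed (simp_all add: ninth_def)

text \<open>
  The window of the nine latest values is kept in nine arguments rather than in a list, so that the
  evaluation spends nothing on list operations.
\<close>

fun avg_run :: "nat \<Rightarrow> int \<Rightarrow> int \<Rightarrow> int \<Rightarrow> int \<Rightarrow> int \<Rightarrow> int \<Rightarrow> int \<Rightarrow> int \<Rightarrow> int \<Rightarrow> int" where
  "avg_run 0 a b c d e f g h i = i"
| "avg_run (Suc n) a b c d e f g h i =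
     avg_run n b c d e f g h i (ninth (a + b + c + d + e + f + g + h + i))"

text \<open>
  If all nine values in the window lie in \<open>[x, x + E]\<close> for their approximations \<open>x\<close>, then so does
  their mean, and rounding it down widens the interval by less than one.
\<close>

lemma avg_run_error:
  fixes w :: "nat \<Rightarrow> real" and K E :: real
  assumes rec: "\<And>m. w (m + 9) = (\<Sum>i<9. w (m + i)) / 9"
    and "of_int a \<le> K * w m" "K * w m \<le> of_int a + E"
    and "of_int b \<le> K * w (m + 1)" "K * w (m + 1) \<le> of_int b + E"
    and "of_int c \<le> K * w (m + 2)" "K * w (m + 2) \<le> of_int c + E"
    and "of_int d \<le> K * w (m + 3)" "K * w (m + 3) \<le> of_int d + E"
    and "of_int e \<le> K * w (m + 4)" "K * w (m + 4) \<le> of_int e + E"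
    and "of_int f \<le> K * w (m + 5)" "K * w (m + 5) \<le> of_int f + E"
    and "of_int g \<le> K * w (m + 6)" "K * w (m + 6) \<le> of_int g + E"
    and "of_int h \<le> K * w (m + 7)" "K * w (m + 7) \<le> of_int h + E"
    and "of_int i \<le> K * w (m + 8)" "K * w (m + 8) \<le> of_int i + E"
    and "0 \<le> E"
  shows "of_int (avg_run n a b c d e f g h i) \<le> K * w (m + n + 8)
    \<and> K * w (m + n + 8) \<le> of_int (avg_run n a b c d e f g h i) + (E + n)"
  using assms(2-)
proof (induction n arbitrary: m a b c d e f g h i E)
  case 0
  then show ?case by simp
next
  case (Suc n)
  define s where "s = a + b + c + d + e + f + g + h + i"
  \<comment> \<open>multiplied by 9, the new value and its approximation are linear in the old ones\<close>
  have Kw: "9 * (K * w (m + 9)) = K * w m + K * w (m + 1) + K * w (m + 2) + K * w (m + 3)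
      + K * w (m + 4) + K * w (m + 5) + K * w (m + 6) + K * w (m + 7) + K * w (m + 8)"
    unfolding rec by (simp add: lessThan_nat_numeral lessThan_Suc algebra_simps)
  have "of_int s \<le> 9 * (K * w (m + 9))" "9 * (K * w (m + 9)) \<le> of_int s + 9 * E"
    unfolding Kw s_def of_int_add using Suc.prems by linarith+
  moreover have "9 * ninth s \<le> s" "s \<le> 9 * ninth s + 8"
    unfolding ninth_def by presburger+
  then have "9 * real_of_int (ninth s) \<le> of_int s" "of_int s \<le> 9 * real_of_int (ninth s) + 8"
    by linarith+
  ultimately have new: "of_int (ninth s) \<le> K * w (m + 9)"
    "K * w (m + 9) \<le> of_int (ninth s) + (E + 1)"
    by linarith+
  have "of_int (avg_run n b c d e f g h i (ninth s)) \<le> K * w (Suc m + n + 8)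
    \<and> K * w (Suc m + n + 8) \<le> of_int (avg_run n b c d e f g h i (ninth s)) + ((E + 1) + n)"
    by (rule Suc.IH) (use Suc.prems new in \<open>auto simp: eval_nat_numeral\<close>)
  then show ?case
    by (simp add: s_def add_ac)
qed

lemma avg_run_666:
  "avg_run 666 0 0 0 0 0 0 0 0 (10 ^ 94) =
    1999999999999999999999999999999999999999999999999999999999999997833777316286476055279462594007"
  by code_simp

section \<open>Reading off the digits\<close>

text \<open>
  A single integer determines the first digits: \<open>\<lfloor>x * 10 ^ n\<rfloor>\<close> is obtained from
  \<open>\<lfloor>x * 10 ^ (n + 1)\<rfloor>\<close> by dropping the last digit. Evaluating the digit list by Horner's rule avoids
  divisions by large powers of ten.
\<close>

lemma decimal_expansion_begins_floor:
  assumes "\<And>c. c \<in> set ds \<Longrightarrow> 0 \<le> c \<and> c < 10"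
    and "\<lfloor>x * 10 ^ length ds\<rfloor> = foldl (\<lambda>a c. 10 * a + c) (int m) ds"
  shows "decimal_expansion_begins x m ds"
  using assms
proof (induction ds rule: rev_induct)
  case Nil
  then show ?case by (simp add: decimal_expansion_begins_def)
next
  case (snoc c ds)
  let ?F = "foldl (\<lambda>a c. 10 * a + c) (int m) ds"
  have c: "0 \<le> c" "c < 10"
    using snoc.prems(1)[of c] by auto
  have floor: "\<lfloor>x * 10 ^ Suc (length ds)\<rfloor> = 10 * ?F + c"
    using snoc.prems(2) by simp
  have "x * 10 ^ length ds = x * 10 ^ Suc (length ds) / of_int 10"
    by simp
  then have "\<lfloor>x * 10 ^ length ds\<rfloor> = \<lfloor>x * 10 ^ Suc (length ds)\<rfloor> div 10"
    by (simp only:) (subst floor_divide_real_eq_div, auto)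
  then have "\<lfloor>x * 10 ^ length ds\<rfloor> = ?F"
    using floor c by simp
  then have "decimal_expansion_begins x m ds"
    using snoc.prems(1) by (intro snoc.IH) auto
  moreover have "decimal_digit x (Suc (length ds)) = c"
    unfolding decimal_digit_def floor using c by simp
  ultimately show ?case
    by (auto simp: decimal_expansion_begins_def nth_append less_Suc_eq)
qed

theorem mainTheorem1:
  fixes M :: "'a measure" and d :: "nat \<Rightarrow> 'a \<Rightarrow> nat"
  assumes "prob_space M"
    and "prob_space.indep_vars M (\<lambda>_. count_space UNIV) d {1..}"
    and "distr M (count_space UNIV) (d 1) = measure_pmf (pmf_of_set {1..9})"
    and "\<And>j. j \<ge> 2 \<Longrightarrow> distr M (count_space UNIV) (d j) = measure_pmf (pmf_of_set {0..9})"
  shows "decimal_expansion_begins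
    (measure M {\<omega> \<in> space M. \<exists>k\<ge>1. (\<Sum>j=1..k. d j \<omega>) = 666})
    0
    ([1] @ replicate 62 9 @
     [7,8,3,3,7,7,7,3,1,6,2,8,6,4,7,6,0,5,5,2,7,9,4,6,2,5])"
proof -
  interpret random_digits M d
    using assms by (simp add: random_digits_def random_digits_axioms_def)
  let ?x = "measure M {\<omega> \<in> space M. \<exists>k\<ge>1. (\<Sum>j=1..k. d j \<omega>) = 666}"
  \<comment> \<open>index 674 = 666 + 8 because of the eight zeros in front of the sequence\<close>
  have "?x = padded_hit 674"
    by (simp add: padded_hit_def hit_def digit_sum_def)
  \<comment> \<open>the initial window consists of eight zeros and a one, which are represented exactly\<close>
  moreover have
    "of_int (avg_run 666 0 0 0 0 0 0 0 0 (10 ^ 94)) \<le> 10 ^ 94 * padded_hit (0 + 666 + 8)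
      \<and> 10 ^ 94 * padded_hit (0 + 666 + 8)
          \<le> of_int (avg_run 666 0 0 0 0 0 0 0 0 (10 ^ 94)) + (0 + real 666)"
    by (rule avg_run_error[OF padded_hit_average]) (simp_all add: padded_hit_def)
  ultimately have bounds: "1999999999999999999999999999999999999999999999999999999999999997833777316286476055279462594007 \<le> 10 ^ 94 * ?x"
    "10 ^ 94 * ?x \<le> 1999999999999999999999999999999999999999999999999999999999999997833777316286476055279462594673"
    unfolding avg_run_666 by simp_all
  let ?ds = "[1] @ replicate 62 9 @
    [7,8,3,3,7,7,7,3,1,6,2,8,6,4,7,6,0,5,5,2,7,9,4,6,2,5] :: int list"
  have "foldl (\<lambda>a c. 10 * a + c) (int 0) ?ds =
    19999999999999999999999999999999999999999999999999999999999999978337773162864760552794625"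
    by code_simp
  moreover have "length ?ds = 89"
    by simp
  ultimately have "\<lfloor>?x * 10 ^ length ?ds\<rfloor> = foldl (\<lambda>a c. 10 * a + c) (int 0) ?ds"
    using bounds by (simp only:) (intro floor_unique, simp_all)
  then show ?thesis
    by (rule decimal_expansion_begins_floor[rotated]) auto
qed

end
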